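(* Let $a,b,c,d,f$ be integers with $a>c>0$ and $b<d+f+1/2$. Then the sequence $$\left\{\sqrt[n]{\frac{\Gamma(an+b+1)}{\Gamma(cn+d+1)\,\Gamma((a-c)n+f+1)}}\right\}_{n\geq 1}$$ is asymptotically log-concave. In particular, for integers $a>c>0$, the sequence $\left\{\sqrt[n]{\binom{an}{cn}}\right\}_{n\geq 30}$ is strictly log-concave, and for integers $a>c>0$ and $f\geq 1$, the sequence $$\left\{\sqrt[n]{\frac{\Gamma(an+1)}{\Gamma(cn+1)\,\Gamma((a-c)n+f+1)}}\right\}_{n\geq 2}$$ is strictly log-concave.
   Context: $\Gamma$ is the Euler Gamma function. A sequence of positive numbers $\{z_n\}_{n\geq m}$ is log-concave (resp. strictly log-concave) if $z_{n-1}z_{n+1}\leq z_n^2$ (resp. $z_{n-1}z_{n+1}<z_n^2$) for all $n\geq m+1$. A sequence is asymptotically log-concave if there is $N$ such that $\{z_n\}_{n\geq N}$ is (defined, positive and) log-concave. *)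

theory Defs
  imports "HOL-Analysis.Analysis"
begin

definition log_concave_from :: "nat \<Rightarrow> (nat \<Rightarrow> real) \<Rightarrow> bool" where
  "log_concave_from m z \<longleftrightarrow>
     (\<forall>n\<ge>m. z n > 0) \<and> (\<forall>n\<ge>m + 1. z (n - 1) * z (n + 1) \<le> (z n)\<^sup>2)"

definition strictly_log_concave_from :: "nat \<Rightarrow> (nat \<Rightarrow> real) \<Rightarrow> bool" where
  "strictly_log_concave_from m z \<longleftrightarrow>
     (\<forall>n\<ge>m. z n > 0) \<and> (\<forall>n\<ge>m + 1. z (n - 1) * z (n + 1) < (z n)\<^sup>2)"

definition asymptotically_log_concave :: "(nat \<Rightarrow> real) \<Rightarrow> bool" where
  "asymptotically_log_concave z \<longleftrightarrow> (\<exists>N. log_concave_from N z)"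

(* Since Gamma is 0 at its poles, x / 0 = 0 and root 0 x = 0, a positive value of this
   sequence is always a genuine one: n \<ge> 1 and no Gamma argument is a pole.  So the
   positivity part of log_concave_from includes definedness of the terms. *)
definition gamma_root_seq :: "int \<Rightarrow> int \<Rightarrow> int \<Rightarrow> int \<Rightarrow> int \<Rightarrow> nat \<Rightarrow> real" where
  "gamma_root_seq a b c d f n =
     root n (Gamma (of_int (a * int n + b + 1)) /
             (Gamma (of_int (c * int n + d + 1)) * Gamma (of_int ((a - c) * int n + f + 1))))"

end

(*
  Write z_n = exp (g n / n) with g x = ln Gamma(ax+b+1) - ln Gamma(cx+d+1) - ln Gamma((a-c)x+f+1).
  Then (g/x)'' = u/x^3 where u = x^2 g'' - 2 x g' + 2 g satisfies u' = x^2 g''', so everything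
  hinges on the sign of g'''.  In general x^3 g''' tends to -2(d+f+1/2-b) < 0, so u' is bounded
  above by a negative multiple of 1/x and u tends to -infinity.  For b = d = 0 and f >= 0 we have
  u(0) = -2 ln(f!) <= 0, and g''' < 0 on the whole positive axis, so g/x is strictly concave
  there; both explicit sequences are therefore strictly log-concave already from n = 1.
  With e = a - c, the inequality g''' < 0 reduces to
  sum_k 1/(x+k/c)^3 + sum_k 1/(x+k/e)^3 < sum_k 1/(x+k/(c+e))^3 (sums over k >= 1), which holds
  because floor(ct) + floor(et) <= floor((c+e)t): listing the points k/c and k/e together in
  increasing order, the m-th one is at least m/(c+e).
*)
theory Submission
  imports Defs "HOL-Real_Asymp.Real_Asymp"
begin

section \<open>Strict concavity of \<open>g x / x\<close> and log-concavity of n-th roots\<close>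

text \<open>The expression assumed negative is \<open>y ^ 3\<close> times the second derivative of
  \<open>g y / y\<close>, so the first derivative strictly decreases. Mean value points on either
  side of \<open>x\<close> then compare the two unit increments.\<close>

lemma midpoint_strict_concave_quotient:
  fixes g g' g'' :: "real \<Rightarrow> real"
  assumes "r > 0" "r \<le> x - 1"
    and g: "\<And>y. y \<ge> r \<Longrightarrow> (g has_field_derivative g' y) (at y)"
    and g': "\<And>y. y \<ge> r \<Longrightarrow> (g' has_field_derivative g'' y) (at y)"
    and neg: "\<And>y. y \<ge> r \<Longrightarrow> y\<^sup>2 * g'' y - 2 * y * g' y + 2 * g y < 0"
  shows "g (x - 1) / (x - 1) + g (x + 1) / (x + 1) < 2 * (g x / x)"
proof -
  define q where "q = (\<lambda>y. g y / y)"
  define q' where "q' = (\<lambda>y. g' y / y - g y / y\<^sup>2)"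
  have q: "(q has_field_derivative q' y) (at y)" if "y \<ge> r" for y
    unfolding q_def q'_def using that \<open>r > 0\<close>
    by (auto intro!: derivative_eq_intros g simp: field_simps power2_eq_square)
  have q': "(q' has_field_derivative (y\<^sup>2 * g'' y - 2 * y * g' y + 2 * g y) / y ^ 3) (at y)"
    if "y \<ge> r" for y
    unfolding q'_def using that \<open>r > 0\<close>
    by (auto intro!: derivative_eq_intros g g'
        simp: field_simps power2_eq_square power3_eq_cube)
  have q'_less: "q' t < q' s" if "r \<le> s" "s < t" for s t
  proof (rule DERIV_neg_imp_decreasing[OF \<open>s < t\<close>])
    fix y assume "s \<le> y" "y \<le> t"
    then have "r \<le> y" "y > 0" using that \<open>r > 0\<close> by auto
    then show "\<exists>z. (q' has_field_derivative z) (at y) \<and> z < 0"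
      using q'[of y] neg[of y] by (auto intro!: exI divide_neg_pos)
  qed
  obtain s where s: "x - 1 < s" "s < x" "q x - q (x - 1) = (x - (x - 1)) * q' s"
    using MVT2[of "x - 1" x q q'] q assms(2) by auto
  obtain t where t: "x < t" "t < x + 1" "q (x + 1) - q x = (x + 1 - x) * q' t"
    using MVT2[of x "x + 1" q q'] q assms(2) by auto
  have "q' t < q' s" using q'_less s t assms(2) by auto
  then show ?thesis using s t by (simp add: q_def)
qed

text \<open>Since the n-th root of \<open>exp (g n)\<close> is \<open>exp (g n / n)\<close>, strict
  log-concavity at \<open>n\<close> is the exponentiated midpoint inequality for
  \<open>g y / y\<close>.\<close>

lemma strictly_log_concave_from_root_exp:
  fixes g g' g'' :: "real \<Rightarrow> real"
  assumes "m \<ge> 1"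
    and z: "\<And>n. n \<ge> m \<Longrightarrow> z n = root n (exp (g (real n)))"
    and "\<And>y. y \<ge> real m \<Longrightarrow> (g has_field_derivative g' y) (at y)"
    and "\<And>y. y \<ge> real m \<Longrightarrow> (g' has_field_derivative g'' y) (at y)"
    and "\<And>y. y \<ge> real m \<Longrightarrow> y\<^sup>2 * g'' y - 2 * y * g' y + 2 * g y < 0"
  shows "strictly_log_concave_from m z"
proof -
  \<comment> \<open>\<open>m \<ge> 1\<close> excludes the index 0, where \<open>root 0\<close> takes
    the default value 0.\<close>
  have z_exp: "z n = exp (g (real n) / real n)" if "n \<ge> m" for n
  proof -
    have "exp (g (real n)) = exp (g (real n) / real n) ^ n"
      using that \<open>m \<ge> 1\<close> by (simp flip: exp_of_nat_mult)
    then show ?thesis using z[OF that] that \<open>m \<ge> 1\<close> by (simp add: real_root_power_cancel)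
  qed
  have "z (n - 1) * z (n + 1) < (z n)\<^sup>2" if "n \<ge> m + 1" for n
  proof -
    have "g (real n - 1) / (real n - 1) + g (real n + 1) / (real n + 1) < 2 * (g (real n) / real n)"
      by (rule midpoint_strict_concave_quotient[of "real m" _ g g' g'']) (use assms that in auto)
    then have "exp (g (real (n - 1)) / real (n - 1)) * exp (g (real (n + 1)) / real (n + 1))
        < exp (2 * (g (real n) / real n))"
      using that by (simp add: of_nat_diff add.commute flip: exp_add)
    then show ?thesis
      using that by (simp add: z_exp power2_eq_square flip: exp_add)
  qed
  then show ?thesis
    unfolding strictly_log_concave_from_def by (simp add: z_exp)
qed

text \<open>Serves to pass from starting index 1 to the starting indices 30 and 2.\<close>

lemma strictly_log_concave_from_mono:
  "strictly_log_concave_from m z \<Longrightarrow> m \<le> n \<Longrightarrow> strictly_log_concave_from n z"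
  unfolding strictly_log_concave_from_def by auto

lemma strictly_log_concave_from_imp_log_concave_from:
  "strictly_log_concave_from m z \<Longrightarrow> log_concave_from m z"
  unfolding strictly_log_concave_from_def log_concave_from_def by (auto intro: less_imp_le)

section \<open>Derivatives of logarithms of Gamma quotients\<close>

text \<open>Where \<open>a * x + b > 0\<close>, this is the \<open>k\<close>-th derivative of ln
  Gamma(ax+b). Indexing by \<open>k\<close> lets one differentiation rule cover all orders.\<close>

definition ln_Gamma_affine :: "nat \<Rightarrow> real \<Rightarrow> real \<Rightarrow> real \<Rightarrow> real" where
  "ln_Gamma_affine k a b x =
     (if k = 0 then ln_Gamma (a * x + b) else a ^ k * Polygamma (k - 1) (a * x + b))"

lemma has_field_derivative_ln_Gamma_affine:
  assumes "a * x + b > 0"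
  shows "(ln_Gamma_affine k a b has_field_derivative ln_Gamma_affine (Suc k) a b x) (at x)"
proof -
  have "a * x + b \<notin> \<int>\<^sub>\<le>\<^sub>0" using assms by (auto elim!: nonpos_Ints_cases)
  then show ?thesis
    using assms unfolding ln_Gamma_affine_def[abs_def]
    by (cases k) (auto intro!: derivative_eq_intros)
qed

definition ln_Gamma_ratio ::
    "nat \<Rightarrow> real \<Rightarrow> real \<Rightarrow> real \<Rightarrow> real \<Rightarrow> real \<Rightarrow> real \<Rightarrow> real \<Rightarrow> real" where
  "ln_Gamma_ratio k a b c d e f x =
     ln_Gamma_affine k a b x - ln_Gamma_affine k c d x - ln_Gamma_affine k e f x"

lemma has_field_derivative_ln_Gamma_ratio:
  assumes "a * x + b > 0" "c * x + d > 0" "e * x + f > 0"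
  shows "(ln_Gamma_ratio k a b c d e f has_field_derivative
          ln_Gamma_ratio (Suc k) a b c d e f x) (at x)"
  unfolding ln_Gamma_ratio_def[abs_def]
  by (intro DERIV_diff has_field_derivative_ln_Gamma_affine assms)

text \<open>If \<open>G k\<close> is the \<open>k\<close>-th derivative of \<open>g\<close>, this is \<open>x\<^sup>3\<close> times the second derivative of
  \<open>g x / x\<close>.\<close>

definition quotient_curvature :: "(nat \<Rightarrow> real \<Rightarrow> real) \<Rightarrow> real \<Rightarrow> real" where
  "quotient_curvature G x = x\<^sup>2 * G 2 x - 2 * x * G 1 x + 2 * G 0 x"

text \<open>By the product rule the contributions of \<open>G 1\<close> and \<open>G 2\<close>
  cancel, leaving only the third derivative.\<close>

lemma has_field_derivative_quotient_curvature:
  assumes "\<And>k. (G k has_field_derivative G (Suc k) x) (at x)"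
  shows "(quotient_curvature G has_field_derivative x\<^sup>2 * G 3 x) (at x)"
  unfolding quotient_curvature_def[abs_def]
  using assms[of 0] assms[of 1] assms[of 2]
  by (auto intro!: derivative_eq_intros simp: numeral_2_eq_2 numeral_3_eq_3 algebra_simps)

lemma gamma_root_seq_conv_ln_Gamma_ratio:
  assumes "real_of_int a * real n + (b + 1) > 0" "real_of_int c * real n + (d + 1) > 0"
    "real_of_int (a - c) * real n + (f + 1) > 0"
  shows "gamma_root_seq a b c d f n =
    root n (exp (ln_Gamma_ratio 0 a (b + 1) c (d + 1) (a - c) (f + 1) n))"
  using assms
  by (simp add: gamma_root_seq_def ln_Gamma_ratio_def ln_Gamma_affine_def Gamma_real_pos_exp
      exp_diff exp_add add.assoc field_simps)

section \<open>Comparison of series by merging multiples of 1/c and 1/e\<close>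

text \<open>The maps \<open>r\<close> and \<open>s\<close> match the terms of \<open>p\<close> and
  \<open>q\<close> with larger terms of \<open>f\<close> at disjoint sets of indices; the unmatched
  terms of \<open>f\<close> are nonnegative.\<close>

lemma sum_of_disjoint_dominated:
  fixes f p q :: "nat \<Rightarrow> real"
  assumes f: "(f has_sum S) UNIV" and p: "(p has_sum P) UNIV" and q: "(q has_sum Q) UNIV"
    and nonneg: "\<And>n. f n \<ge> 0"
    and inj: "inj r" "inj s" and disj: "range r \<inter> range s = {}"
    and p_less: "\<And>n. p n < f (r n)" and q_le: "\<And>n. q n \<le> f (s n)"
  shows "P + Q < S"
proof -
  have summ: "f summable_on A" for A
    using f summable_on_subset_banach by (metis subset_UNIV summable_on_def)
  obtain S1 S2 where S1: "(f has_sum S1) (range r)" and S2: "(f has_sum S2) (range s)"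
    using summ by (meson summable_on_def)
  have "((\<lambda>n. f (r n)) has_sum S1) UNIV" "((\<lambda>n. f (s n)) has_sum S2) UNIV"
    using S1 S2 has_sum_reindex[OF inj(1), of f] has_sum_reindex[OF inj(2), of f]
    by (simp_all add: o_def)
  then have "P < S1" "Q \<le> S2"
    using has_sum_strict_mono[OF p, of _ S1 0] has_sum_mono[OF q] p_less q_le less_imp_le
    by (auto simp: less_imp_le)
  moreover have "S1 + S2 \<le> S"
    by (rule has_sum_mono2[OF has_sum_Un_disjoint[OF S1 S2 disj] f]) (use nonneg in auto)
  ultimately show ?thesis by simp
qed

text \<open>The two sides are the zero-based positions of \<open>(k + 1) / c\<close> and \<open>(j + 1) / e\<close> in the merged
  list of multiples of \<open>1 / c\<close> and \<open>1 / e\<close>, where ties put the multiple of \<open>1 / c\<close> first.\<close>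

lemma merged_ranks_disjoint:
  fixes c e k j :: nat
  assumes "c > 0" "e > 0"
  shows "k + (Suc k * e - 1) div c \<noteq> j + Suc j * c div e"
proof (cases "Suc k * e \<le> Suc j * c")
  case True
  \<comment> \<open>Here (k+1)/c comes no later than (j+1)/e, so the left rank is at most
    \<open>k + j\<close> and the right one at least \<open>k + j + 1\<close>.\<close>
  then have "Suc k \<le> Suc j * c div e" using assms by (simp add: less_eq_div_iff_mult_less_eq)
  moreover have "(Suc k * e - 1) div c < Suc j"
  proof -
    have "Suc k * e - 1 < Suc j * c" using True assms by (cases e) auto
    then show ?thesis using assms less_mult_imp_div_less by blast
  qed
  ultimately show ?thesis by linarith
next
  case False
  then have "Suc j \<le> (Suc k * e - 1) div c"
    using assms by (simp add: less_eq_div_iff_mult_less_eq)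
  moreover have "Suc j * c div e < Suc k"
    using False assms less_mult_imp_div_less[of "Suc j * c" "Suc k" e] by auto
  ultimately show ?thesis by linarith
qed

lemma inj_add_mono:
  fixes h :: "nat \<Rightarrow> nat"
  assumes "mono h"
  shows "inj (\<lambda>n. n + h n)"
proof (rule strict_mono_imp_inj_on[of "\<lambda>n. n + h n"])
  show "strict_mono (\<lambda>n. n + h n)"
    by (rule strict_monoI) (use monoD[OF assms] in \<open>simp add: add_less_le_mono\<close>)
qed

text \<open>Rescales the series of \<open>Polygamma 2\<close> by
  \<open>a * x + 1 + n = a * (x + (n + 1) / a)\<close>. As the terms are nonnegative, it also
  converges as an unordered sum, which permits reindexing.\<close>

lemma Polygamma_2_has_sum:
  fixes a x :: real
  assumes "a > 0" "x > 0"
  shows "((\<lambda>n. 1 / (x + real (Suc n) / a) ^ 3) has_sum - (a ^ 3 * Polygamma 2 (a * x + 1)) / 2) UNIV"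
proof -
  have "(\<lambda>n. inverse ((a * x + 1 + of_nat n) ^ Suc 2)) sums
      ((-1) ^ Suc 2 * Polygamma 2 (a * x + 1) / fact 2)"
    using assms by (intro Polygamma_LIMSEQ) (auto simp: add_nonneg_eq_0_iff add_pos_pos less_imp_neq[symmetric])
  from sums_mult[OF this, of "a ^ 3"]
  have "(\<lambda>n. a ^ 3 * inverse ((a * x + 1 + real n) ^ 3)) sums (- (a ^ 3 * Polygamma 2 (a * x + 1)) / 2)"
    by (simp add: numeral_3_eq_3)
  moreover have "a ^ 3 * inverse ((a * x + 1 + real n) ^ 3) = 1 / (x + real (Suc n) / a) ^ 3" for n
  proof -
    have "x + real (Suc n) / a = (a * x + 1 + real n) / a" using assms by (simp add: field_simps)
    then show ?thesis by (simp add: power_divide field_simps)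
  qed
  ultimately show ?thesis
    using assms by (intro sums_nonneg_imp_has_sum) auto
qed

lemma Polygamma_2_strict_subadditive:
  fixes c e :: nat and x :: real
  assumes "c > 0" "e > 0" "x > 0"
  shows "real (c + e) ^ 3 * Polygamma 2 (real (c + e) * x + 1)
    < real c ^ 3 * Polygamma 2 (real c * x + 1) + real e ^ 3 * Polygamma 2 (real e * x + 1)"
proof -
  \<comment> \<open>These are the ranks of the multiples of 1/c and 1/e in the merged list. The
    entry of zero-based rank \<open>m\<close> is at least \<open>(m + 1) / (c + e)\<close>, so its
    term is bounded by the one of index \<open>m\<close> in the series for
    \<open>c + e\<close>.\<close>
  define r s where "r = (\<lambda>k. k + (Suc k * e - 1) div c)" and "s = (\<lambda>j. j + Suc j * c div e)"
  have "- (real c ^ 3 * Polygamma 2 (real c * x + 1)) / 2 + - (real e ^ 3 * Polygamma 2 (real e * x + 1)) / 2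
     < - (real (c + e) ^ 3 * Polygamma 2 (real (c + e) * x + 1)) / 2"
  proof (rule sum_of_disjoint_dominated[where r = r and s = s,
        OF Polygamma_2_has_sum Polygamma_2_has_sum Polygamma_2_has_sum])
    show "inj r" "inj s" unfolding r_def s_def
      by (intro inj_add_mono monoI div_le_mono diff_le_mono mult_le_mono; simp)+
    show "range r \<inter> range s = {}"
      using merged_ranks_disjoint[OF assms(1,2)] by (auto simp: r_def s_def)
    fix n
    \<comment> \<open>Subtracting 1 before dividing makes the bound for \<open>r\<close> strict; the
      bound for \<open>s\<close> below is only weak.\<close>
    have "c * ((Suc n * e - 1) div c) \<le> Suc n * e - 1" by (rule times_div_less_eq_dividend)
    moreover have "Suc n * e > 0" using assms by simp
    ultimately have "c * ((Suc n * e - 1) div c) < Suc n * e" by linarith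
    then have "c * Suc (r n) < Suc n * (c + e)" by (simp add: r_def algebra_simps)
    then have "real c * real (Suc (r n)) < real (Suc n) * real (c + e)"
      by (metis of_nat_less_iff of_nat_mult)
    then have "real (Suc (r n)) / real (c + e) < real (Suc n) / real c"
      using assms by (simp add: divide_simps mult.commute)
    then show "1 / (x + real (Suc n) / real c) ^ 3 < 1 / (x + real (Suc (r n)) / real (c + e)) ^ 3"
      using assms by (intro divide_strict_left_mono power_strict_mono mult_pos_pos zero_less_power add_pos_nonneg) auto
    have "e * (Suc n * c div e) \<le> Suc n * c" by simp
    then have "e * Suc (s n) \<le> Suc n * (c + e)" by (simp add: s_def algebra_simps)
    then have "real e * real (Suc (s n)) \<le> real (Suc n) * real (c + e)"
      by (metis of_nat_le_iff of_nat_mult)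
    then have "real (Suc (s n)) / real (c + e) \<le> real (Suc n) / real e"
      using assms by (simp add: divide_simps mult.commute)
    then show "1 / (x + real (Suc n) / real e) ^ 3 \<le> 1 / (x + real (Suc (s n)) / real (c + e)) ^ 3"
      using assms by (intro divide_left_mono power_mono mult_pos_pos zero_less_power add_pos_nonneg) auto
  qed (use assms in auto)
  then show ?thesis by simp
qed

section \<open>Bounds for \<open>Polygamma 2\<close> and the third derivative at infinity\<close>

text \<open>Midpoint rule for the convex function 2/t^3: the term 2/z^3 is at most its integral over
  [z-1/2, z+1/2], and these integrals telescope.\<close>

lemma Polygamma_2_ge:
  fixes y :: real
  assumes "y > 1 / 2"
  shows "- (1 / (y - 1 / 2)\<^sup>2) \<le> Polygamma 2 y"
proof -
  define F where "F = (\<lambda>n. 1 / (y + real n - 1 / 2)\<^sup>2)"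
  have "F \<longlonglongrightarrow> 0" unfolding F_def by real_asymp
  from telescope_sums'[OF this] have 1: "(\<lambda>n. F n - F (Suc n)) sums F 0" by simp
  have "(\<lambda>n. 2 * inverse ((y + of_nat n) ^ Suc 2)) sums
      (2 * ((-1) ^ Suc 2 * Polygamma 2 y / fact 2))"
    using assms by (intro sums_mult Polygamma_LIMSEQ) auto
  then have 2: "(\<lambda>n. 2 * inverse ((y + of_nat n) ^ 3)) sums (- Polygamma 2 y)"
    by (simp add: numeral_3_eq_3)
  have "2 * inverse (z ^ 3) \<le> 1 / (z - 1 / 2)\<^sup>2 - 1 / (z + 1 / 2)\<^sup>2" if "z > 1 / 2" for z :: real
  proof -
    have "1 / 4 < z\<^sup>2" using that power_strict_mono[of "1/2" z 2] by (simp add: power2_eq_square)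
    have "1 / (z - 1 / 2)\<^sup>2 - 1 / (z + 1 / 2)\<^sup>2
        = ((z + 1 / 2)\<^sup>2 - (z - 1 / 2)\<^sup>2) / ((z - 1 / 2)\<^sup>2 * (z + 1 / 2)\<^sup>2)"
      using that by (subst diff_frac_eq) auto
    also have "(z + 1 / 2)\<^sup>2 - (z - 1 / 2)\<^sup>2 = 2 * z"
      by (simp add: power2_eq_square algebra_simps)
    also have "(z - 1 / 2)\<^sup>2 * (z + 1 / 2)\<^sup>2 = (z\<^sup>2 - 1 / 4)\<^sup>2"
      by (simp add: power2_eq_square algebra_simps)
    finally have "1 / (z - 1 / 2)\<^sup>2 - 1 / (z + 1 / 2)\<^sup>2 = 2 * z / (z\<^sup>2 - 1 / 4)\<^sup>2" .
    moreover have "2 * z / (z\<^sup>2)\<^sup>2 \<le> 2 * z / (z\<^sup>2 - 1 / 4)\<^sup>2"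
      using that \<open>1 / 4 < z\<^sup>2\<close>
      by (intro divide_left_mono power_mono mult_pos_pos) auto
    moreover have "2 * z / (z\<^sup>2)\<^sup>2 = 2 * inverse (z ^ 3)"
      using that by (simp add: field_simps eval_nat_numeral)
    ultimately show ?thesis by simp
  qed
  from this[of "y + real n" for n] have "- Polygamma 2 y \<le> F 0"
    using assms by (intro sums_le[OF _ 2 1]) (auto simp: F_def algebra_simps)
  then show ?thesis by (simp add: F_def)
qed

text \<open>Trapezoidal rule for 2/t^3 on [z, z+1], rearranged so that it telescopes. Both bounds
  agree with \<open>Polygamma 2\<close> in the terms of order 1/y^2 and 1/y^3, which is the
  precision that the limit of x^3 g''' demands.\<close>

lemma Polygamma_2_le:
  fixes y :: real
  assumes "y > 0"
  shows "Polygamma 2 y \<le> - (1 / y\<^sup>2 + 1 / y ^ 3)"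
proof -
  define F where "F = (\<lambda>n. 1 / (y + real n)\<^sup>2 + 1 / (y + real n) ^ 3)"
  have "F \<longlonglongrightarrow> 0" unfolding F_def by real_asymp
  from telescope_sums'[OF this] have 1: "(\<lambda>n. F n - F (Suc n)) sums F 0" by simp
  have "(\<lambda>n. 2 * inverse ((y + of_nat n) ^ Suc 2)) sums
      (2 * ((-1) ^ Suc 2 * Polygamma 2 y / fact 2))"
    using assms by (intro sums_mult Polygamma_LIMSEQ) auto
  then have 2: "(\<lambda>n. 2 * inverse ((y + of_nat n) ^ 3)) sums (- Polygamma 2 y)"
    by (simp add: numeral_3_eq_3)
  have "1 / z\<^sup>2 + 1 / z ^ 3 - (1 / (z + 1)\<^sup>2 + 1 / (z + 1) ^ 3) \<le> 2 * inverse (z ^ 3)" if "z > 0" for z :: real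
  proof -
    have "2 * inverse (z ^ 3) - (1 / z\<^sup>2 + 1 / z ^ 3 - (1 / (z + 1)\<^sup>2 + 1 / (z + 1) ^ 3))
       = (2 * z + 1) / (z * (z + 1)) ^ 3"
    proof -
      have "z + 1 \<noteq> 0" "z \<noteq> 0" using that by auto
      then show ?thesis by (simp add: power_mult_distrib divide_simps) (simp add: eval_nat_numeral algebra_simps)
    qed
    also have "\<dots> \<ge> 0" using that by simp
    finally show ?thesis by simp
  qed
  from this[of "y + real n" for n] have "F 0 \<le> - Polygamma 2 y"
    using assms by (intro sums_le[OF _ 1 2]) (auto simp: F_def algebra_simps)
  then show ?thesis by (simp add: F_def)
qed

text \<open>With \<open>y = a * x + b\<close> the numerator becomes (y-b)^3, and expanding in powers
  of 1/y gives the limits. The linear growth \<open>a * x\<close> is removed because it cancels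
  between numerator and denominator of the Gamma quotient.\<close>

lemma tendsto_affine_powers:
  fixes a b :: real
  assumes "a > 0"
  shows "((\<lambda>x. x ^ 3 * (a ^ 3 / (a * x + b)\<^sup>2) - a * x) \<longlongrightarrow> - 2 * b) at_top" (is ?A)
    and "((\<lambda>x. x ^ 3 * (a ^ 3 / (a * x + b) ^ 3)) \<longlongrightarrow> 1) at_top" (is ?B)
proof -
  define t where "t = (\<lambda>x. 1 / (a * x + b))"
  have t: "(t \<longlongrightarrow> 0) at_top" unfolding t_def using assms by real_asymp
  have ev: "\<forall>\<^sub>F x in at_top. a * x + b > 0" using assms by real_asymp
  have "((\<lambda>x. - 2 * b + 3 * b\<^sup>2 * t x - b ^ 3 * (t x)\<^sup>2) \<longlongrightarrow> - 2 * b + 3 * b\<^sup>2 * 0 - b ^ 3 * 0\<^sup>2) at_top"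
    by (intro tendsto_intros t)
  moreover have "- 2 * b + 3 * b\<^sup>2 * t x - b ^ 3 * (t x)\<^sup>2 = x ^ 3 * (a ^ 3 / (a * x + b)\<^sup>2) - a * x"
    if "a * x + b > 0" for x
  proof -
    define y where "y = a * x + b"
    have "x ^ 3 * a ^ 3 = (y - b) ^ 3" "a * x = y - b"
      by (simp_all add: y_def power_mult_distrib mult.commute)
    moreover have "- 2 * b + 3 * b\<^sup>2 * (1 / y) - b ^ 3 * (1 / y)\<^sup>2 = (y - b) ^ 3 / y\<^sup>2 - (y - b)"
      using that by (fold y_def, simp add: field_simps) (simp add: eval_nat_numeral algebra_simps)
    ultimately show ?thesis by (simp add: t_def flip: y_def)
  qed
  ultimately show ?A
    by (auto elim!: Lim_transform_eventually intro: eventually_mono[OF ev])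
  have "((\<lambda>x. (1 - b * t x) ^ 3) \<longlongrightarrow> (1 - b * 0) ^ 3) at_top"
    by (intro tendsto_intros t)
  moreover have "(1 - b * t x) ^ 3 = x ^ 3 * (a ^ 3 / (a * x + b) ^ 3)" if "a * x + b > 0" for x
  proof -
    have "1 - b * t x = x * a / (a * x + b)" using that by (simp add: t_def field_simps)
    then show ?thesis by (simp add: power_divide power_mult_distrib)
  qed
  ultimately show ?B
    by (auto elim!: Lim_transform_eventually intro: eventually_mono[OF ev])
qed

text \<open>The upper bound for \<open>Polygamma 2\<close> is applied to the numerator, the lower
  bound to both denominator factors; the linear terms cancel because
  \<open>a = c + e\<close>.\<close>

lemma ln_Gamma_ratio_3_asymp:
  fixes a b c d f :: real
  assumes "a > c" "c > 0" "b < d + f + 1 / 2"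
  defines "\<kappa> \<equiv> d + f + 1 / 2 - b"
  shows "\<forall>\<^sub>F x in at_top. x ^ 3 * ln_Gamma_ratio 3 a (b + 1) c (d + 1) (a - c) (f + 1) x \<le> - \<kappa>"
proof -
  define e where "e = a - c"
  have "e > 0" "a > 0" using assms by (auto simp: e_def)
  define L where "L = (\<lambda>x. x ^ 3 * (a ^ 3 / (a * x + (b + 1))\<^sup>2) - a * x
    + x ^ 3 * (a ^ 3 / (a * x + (b + 1)) ^ 3))"
  \<comment> \<open>The offset \<open>d + 1 / 2\<close> is \<open>d + 1\<close> shifted by the 1/2
    of \<open>Polygamma_2_ge\<close>.\<close>
  define M where "M = (\<lambda>c d x. x ^ 3 * (c ^ 3 / (c * x + (d + 1 / 2))\<^sup>2) - c * x :: real)"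
  have "(L \<longlongrightarrow> - 2 * (b + 1) + 1) at_top"
    unfolding L_def by (intro tendsto_add tendsto_affine_powers \<open>a > 0\<close>)
  then have L: "(L \<longlongrightarrow> - (2 * b + 1)) at_top" by (simp add: algebra_simps)
  have M: "(M c d \<longlongrightarrow> - (2 * d + 1)) at_top" if "c > 0" for c d :: real
    using tendsto_affine_powers(1)[OF that, of "d + 1 / 2"] by (simp add: M_def)
  have "((\<lambda>x. M c d x + M e f x - L x) \<longlongrightarrow> - (2 * d + 1) + - (2 * f + 1) - - (2 * b + 1)) at_top"
    by (intro tendsto_intros L M \<open>c > 0\<close> \<open>e > 0\<close>)
  \<comment> \<open>The limit equals -2\<kappa>, so the bound -\<kappa> leaves room for an eventual
    inequality.\<close>
  moreover have "- (2 * d + 1) + - (2 * f + 1) - - (2 * b + 1) < - \<kappa>"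
    using assms by simp
  ultimately have "\<forall>\<^sub>F x in at_top. M c d x + M e f x - L x < - \<kappa>"
    by (rule order_tendstoD)
  moreover have "\<forall>\<^sub>F x in at_top. a * x + (b + 1) > 0" "\<forall>\<^sub>F x in at_top. c * x + (d + 1) > 1 / 2"
      "\<forall>\<^sub>F x in at_top. e * x + (f + 1) > 1 / 2"
    using \<open>a > 0\<close> \<open>c > 0\<close> \<open>e > 0\<close> by real_asymp+
  ultimately show ?thesis using eventually_gt_at_top[of 0]
  proof eventually_elim
    case (elim x)
    have "x ^ 3 * (a ^ 3 * Polygamma 2 (a * x + (b + 1))) \<le> - (L x + a * x)"
    proof -
      have "x ^ 3 * (a ^ 3 * Polygamma 2 (a * x + (b + 1))) \<le>
         x ^ 3 * (a ^ 3 * - (1 / (a * x + (b + 1))\<^sup>2 + 1 / (a * x + (b + 1)) ^ 3))"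
        using elim \<open>a > 0\<close> by (intro mult_left_mono Polygamma_2_le) auto
      also have "\<dots> = - (L x + a * x)" unfolding L_def by (simp add: algebra_simps)
      finally show ?thesis .
    qed
    moreover have M_le: "- (M c d x + c * x) \<le> x ^ 3 * (c ^ 3 * Polygamma 2 (c * x + (d + 1)))"
      if "c > 0" "c * x + (d + 1) > 1 / 2" for c d
    proof -
      have "- (M c d x + c * x) = x ^ 3 * (c ^ 3 * - (1 / (c * x + (d + 1) - 1 / 2)\<^sup>2))"
        using that(1) by (simp add: M_def add_diff_eq[symmetric])
      also have "\<dots> \<le> x ^ 3 * (c ^ 3 * Polygamma 2 (c * x + (d + 1)))"
        using elim that by (intro mult_left_mono Polygamma_2_ge) auto
      finally show ?thesis .
    qed
    note M_le[of c d] M_le[of e f]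
    moreover have "a * x = c * x + e * x" by (simp add: e_def algebra_simps)
    ultimately show ?case
      using elim \<open>c > 0\<close> \<open>e > 0\<close> unfolding ln_Gamma_ratio_def ln_Gamma_affine_def
      by (simp flip: e_def add: algebra_simps)
  qed
qed


section \<open>The explicit sequences\<close>

text \<open>All Gamma arguments are positive already at \<open>x = 0\<close>, so the curvature can
  be followed from 0, where it is nonpositive, and it strictly decreases from there.\<close>

lemma strictly_log_concave_gamma_root_seq:
  fixes a c f :: int
  assumes "a > c" "c > 0" "f \<ge> 0"
  shows "strictly_log_concave_from 1 (gamma_root_seq a 0 c 0 f)"
proof -
  define C E where "C = nat c" and "E = nat (a - c)"
  have CE: "real_of_int c = real C" "real_of_int a - real_of_int c = real E"
    "real_of_int a = real (C + E)" "C > 0" "E > 0"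
    using assms by (auto simp: C_def E_def)
  define G where "G = (\<lambda>k. ln_Gamma_ratio k (real (C + E)) 1 C 1 E (f + 1))"
  have pos: "real C * x + 1 > 0" "real E * x + (f + 1) > 0" "real (C + E) * x + 1 > 0" if "x \<ge> 0" for x
    using that assms by (auto intro!: add_nonneg_pos)
  have der: "(G k has_field_derivative G (Suc k) x) (at x)" if "x \<ge> 0" for k x
    unfolding G_def by (rule has_field_derivative_ln_Gamma_ratio) (use pos[OF that] in auto)
  have neg3: "G 3 x < 0" if "x > 0" for x
  proof -
    \<comment> \<open>Monotonicity of \<open>Polygamma 2\<close> reduces the sign of
      \<open>G 3\<close> to the case \<open>f = 0\<close>.\<close>
    have "Polygamma 2 (real E * x + 1) \<le> Polygamma 2 (real E * x + (f + 1))"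
      using that assms by (intro Polygamma_real_mono) (auto intro!: add_nonneg_pos)
    then have "real E ^ 3 * Polygamma 2 (real E * x + 1) \<le> real E ^ 3 * Polygamma 2 (real E * x + (f + 1))"
      by (intro mult_left_mono) auto
    then show ?thesis
      using Polygamma_2_strict_subadditive[OF \<open>C > 0\<close> \<open>E > 0\<close> that]
      by (simp add: G_def ln_Gamma_ratio_def ln_Gamma_affine_def)
  qed
  have curv: "quotient_curvature G x < 0" if "x > 0" for x
  proof -
    have dq: "(quotient_curvature G has_field_derivative y\<^sup>2 * G 3 y) (at y)" if "y \<ge> 0" for y
      by (rule has_field_derivative_quotient_curvature) (rule der[OF that])
    have "quotient_curvature G x < quotient_curvature G 0"
    \<comment> \<open>The derivative \<open>y\<^sup>2 * G 3 y\<close> vanishes at 0, so it is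
      negative only on the open interval.\<close>
    proof (rule DERIV_neg_imp_decreasing_open[OF that])
      show "\<exists>z. (quotient_curvature G has_field_derivative z) (at y) \<and> z < 0" if "0 < y" "y < x" for y
        using dq[of y] neg3[of y] that by (auto intro!: exI[of _ "y\<^sup>2 * G 3 y"] mult_pos_neg)
      show "continuous_on {0..x} (quotient_curvature G)"
        by (rule DERIV_atLeastAtMost_imp_continuous_on) (use dq in auto)
    qed
    \<comment> \<open>At 0 only \<open>2 * G 0 0\<close> survives, and its two ln Gamma(1) terms are
      0.\<close>
    also have "quotient_curvature G 0 = - 2 * ln (fact (nat f))"
      using ln_Gamma_real_conv_fact[of "Suc (nat f)"] ln_Gamma_real_conv_fact[of 1] assms
      by (simp add: quotient_curvature_def G_def ln_Gamma_ratio_def ln_Gamma_affine_def add.commute)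
    also have "\<dots> \<le> 0" by simp
    finally show ?thesis .
  qed
  show ?thesis
  proof (rule strictly_log_concave_from_root_exp[of 1 _ "G 0" "G 1" "G 2"])
    fix n :: nat
    show "gamma_root_seq a 0 c 0 f n = root n (exp (G 0 (real n)))"
      using gamma_root_seq_conv_ln_Gamma_ratio[of a n 0 c 0 f] pos[of n] CE by (simp add: G_def)
  next
    fix y :: real assume "real 1 \<le> y"
    then show "(G 0 has_field_derivative G 1 y) (at y)" "(G 1 has_field_derivative G 2 y) (at y)"
      "y\<^sup>2 * G 2 y - 2 * y * G 1 y + 2 * G 0 y < 0"
      using der[of y 0] der[of y 1] curv[of y] by (auto simp: quotient_curvature_def numeral_2_eq_2)
  qed simp
qed

lemma root_binomial_conv_gamma_root_seq:
  fixes a c :: int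
  assumes "a > c" "c > 0"
  shows "root n (real (nat (a * int n) choose nat (c * int n))) = gamma_root_seq a 0 c 0 0 n"
proof -
  have *: "Gamma (of_int (i + 1)) = (fact (nat i) :: real)" if "i \<ge> 0" for i
    using Gamma_fact[of "nat i", where 'a = real] that by (simp add: add.commute)
  have "c * int n \<le> a * int n" using assms by (intro mult_right_mono) auto
  moreover have "nat (a * int n) - nat (c * int n) = nat ((a - c) * int n)"
    using assms \<open>c * int n \<le> a * int n\<close> by (subst nat_diff_distrib[symmetric]) (auto simp: left_diff_distrib)
  ultimately show ?thesis
    using assms *[of "a * int n"] *[of "c * int n"] *[of "(a - c) * int n"]
    by (simp add: gamma_root_seq_def binomial_fact nat_mono del: of_int_add of_int_mult of_int_diff)
qed

section \<open>The general asymptotic case\<close>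

lemma asymptotically_log_concave_gamma_root_seq:
  fixes a b c d f :: int
  assumes "a > c" "c > 0" "real_of_int b < real_of_int d + real_of_int f + 1 / 2"
  shows "asymptotically_log_concave (gamma_root_seq a b c d f)"
proof -
  define \<kappa> where "\<kappa> = real_of_int d + real_of_int f + 1 / 2 - real_of_int b"
  have "\<kappa> > 0" using assms by (simp add: \<kappa>_def)
  define G where "G = (\<lambda>k. ln_Gamma_ratio k a (real_of_int b + 1) c (real_of_int d + 1)
    (real_of_int a - real_of_int c) (real_of_int f + 1))"
  have "\<forall>\<^sub>F x in at_top. x ^ 3 * G 3 x \<le> - \<kappa>"
    unfolding G_def \<kappa>_def by (rule ln_Gamma_ratio_3_asymp) (use assms in auto)
  moreover have "\<forall>\<^sub>F x in at_top. real_of_int a * x + (real_of_int b + 1) > 0" "\<forall>\<^sub>F x in at_top. real_of_int c * x + (real_of_int d + 1) > 0"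
      "\<forall>\<^sub>F x in at_top. (real_of_int a - real_of_int c) * x + (real_of_int f + 1) > 0"
  proof -
    have "\<forall>\<^sub>F x in at_top. p * x + q > 0" if "p > 0" for p q :: real
      using that by real_asymp
    then show "\<forall>\<^sub>F x in at_top. real_of_int a * x + (real_of_int b + 1) > 0" "\<forall>\<^sub>F x in at_top. real_of_int c * x + (real_of_int d + 1) > 0"
        "\<forall>\<^sub>F x in at_top. (real_of_int a - real_of_int c) * x + (real_of_int f + 1) > 0"
      using assms by auto
  qed
  ultimately have "\<forall>\<^sub>F x in at_top. x ^ 3 * G 3 x \<le> - \<kappa> \<and> real_of_int a * x + (real_of_int b + 1) > 0 \<and>
      real_of_int c * x + (real_of_int d + 1) > 0 \<and> (real_of_int a - real_of_int c) * x + (real_of_int f + 1) > 0"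
    by eventually_elim auto
  then obtain X0 where X0: "\<And>x. x \<ge> X0 \<Longrightarrow> x ^ 3 * G 3 x \<le> - \<kappa> \<and> real_of_int a * x + (real_of_int b + 1) > 0 \<and>
      real_of_int c * x + (real_of_int d + 1) > 0 \<and> (real_of_int a - real_of_int c) * x + (real_of_int f + 1) > 0"
    by (auto simp: eventually_at_top_linorder)
  \<comment> \<open>The lower bound 1 keeps \<open>ln\<close> and the division by \<open>y\<close>
    on the positive axis and later yields \<open>N \<ge> 1\<close>.\<close>
  define X where "X = max X0 1"
  have der: "(G k has_field_derivative G (Suc k) x) (at x)" if "x \<ge> X" for k x
    unfolding G_def by (rule has_field_derivative_ln_Gamma_ratio) (use X0[of x] that in \<open>auto simp: X_def\<close>)
  \<comment> \<open>\<open>B\<close> is the value at \<open>X\<close> of curvature plus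
    \<open>\<kappa> * ln x\<close>. This sum is nonincreasing since the curvature has derivative at
    most -\<kappa>/x, so the curvature is negative once \<open>\<kappa> * ln x\<close> exceeds
    \<open>B\<close>.\<close>
  define B where "B = quotient_curvature G X + \<kappa> * ln X"
  have curv_le: "quotient_curvature G x \<le> B - \<kappa> * ln x" if "x \<ge> X" for x
  proof -
    have "quotient_curvature G x + \<kappa> * ln x \<le> B"
      unfolding B_def
    proof (rule DERIV_nonpos_imp_nonincreasing[OF that], intro exI conjI)
      fix y assume "X \<le> y" "y \<le> x"
      then have "y > 0" by (simp add: X_def)
      have "(quotient_curvature G has_field_derivative y\<^sup>2 * G 3 y) (at y)"
        by (rule has_field_derivative_quotient_curvature) (rule der[OF \<open>X \<le> y\<close>])
      then show "((\<lambda>y. quotient_curvature G y + \<kappa> * ln y) has_field_derivative (y ^ 3 * G 3 y + \<kappa>) / y) (at y)"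
        using \<open>y > 0\<close> by (auto intro!: derivative_eq_intros simp: field_simps eval_nat_numeral)
      show "(y ^ 3 * G 3 y + \<kappa>) / y \<le> 0"
        using X0[of y] \<open>X \<le> y\<close> \<open>y > 0\<close> by (intro divide_nonpos_pos) (auto simp: X_def)
    qed
    then show ?thesis by simp
  qed
  have "filterlim (\<lambda>x. \<kappa> * ln x) at_top at_top" using \<open>\<kappa> > 0\<close> by real_asymp
  then have "\<forall>\<^sub>F x in at_top. B < \<kappa> * ln x" by (simp add: filterlim_at_top_dense)
  then obtain Y where Y: "\<And>x. x \<ge> Y \<Longrightarrow> B < \<kappa> * ln x"
    by (auto simp: eventually_at_top_linorder)
  define N where "N = nat \<lceil>max X Y\<rceil>"
  have N: "real N \<ge> X" "real N \<ge> Y" "N \<ge> 1"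
  proof -
    have "real N \<ge> max X Y" unfolding N_def by linarith
    then show "real N \<ge> X" "real N \<ge> Y" by auto
    then have "real N \<ge> 1" by (simp add: X_def)
    then show "N \<ge> 1" by simp
  qed
  have "strictly_log_concave_from N (gamma_root_seq a b c d f)"
  proof (rule strictly_log_concave_from_root_exp[of N _ "G 0" "G 1" "G 2"])
    fix n assume "n \<ge> N"
    then have "real n \<ge> X0" using N by (simp add: X_def)
    then show "gamma_root_seq a b c d f n = root n (exp (G 0 (real n)))"
      using gamma_root_seq_conv_ln_Gamma_ratio[of a n b c d f] X0[of n] by (simp add: G_def)
  next
    fix y :: real assume "real N \<le> y"
    then show "(G 0 has_field_derivative G 1 y) (at y)" "(G 1 has_field_derivative G 2 y) (at y)"
      "y\<^sup>2 * G 2 y - 2 * y * G 1 y + 2 * G 0 y < 0"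
      using der[of y 0] der[of y 1] curv_le[of y] Y[of y] N
      by (auto simp: quotient_curvature_def numeral_2_eq_2)
  qed (use N in simp)
  then show ?thesis
    unfolding asymptotically_log_concave_def
    using strictly_log_concave_from_imp_log_concave_from by blast
qed

theorem proposition3p7:
  shows "(\<forall>a b c d f :: int. a > c \<and> c > 0 \<and> real_of_int b < real_of_int d + real_of_int f + 1 / 2 \<longrightarrow>
            asymptotically_log_concave (gamma_root_seq a b c d f)) \<and>
         (\<forall>a c :: int. a > c \<and> c > 0 \<longrightarrow>
            strictly_log_concave_from 30
              (\<lambda>n. root n (real (nat (a * int n) choose nat (c * int n))))) \<and>
         (\<forall>a c f :: int. a > c \<and> c > 0 \<and> f \<ge> 1 \<longrightarrow>
            strictly_log_concave_from 2 (gamma_root_seq a 0 c 0 f))"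
proof (intro conjI allI impI)
  fix a c :: int assume "a > c \<and> c > 0"
  then show "strictly_log_concave_from 30 (\<lambda>n. root n (real (nat (a * int n) choose nat (c * int n))))"
    using strictly_log_concave_from_mono[OF strictly_log_concave_gamma_root_seq[of c a 0], of 30]
    by (simp add: root_binomial_conv_gamma_root_seq)
next
  fix a c f :: int assume "a > c \<and> c > 0 \<and> f \<ge> 1"
  then show "strictly_log_concave_from 2 (gamma_root_seq a 0 c 0 f)"
    by (intro strictly_log_concave_from_mono[OF strictly_log_concave_gamma_root_seq]) auto
qed (blast intro: asymptotically_log_concave_gamma_root_seq)

end
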